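(* Let $s,t\ge 7$ be integers. Then $$\operatorname{gp}(C_s\boxtimes C_t)\le\begin{cases}9, & 8\in\{s,t\},\\ 10, & 8\notin\{s,t\}\text{ and }\{s,t\}\cap\{7,9,10,12,14,16,18,20\}\ne\varnothing,\\ 11, & \text{otherwise}.\end{cases}$$
   Context: All graphs are finite, simple and connected. $d_G(u,v)$ is the usual shortest-path distance in $G$. A set $S\subseteq V(G)$ is a general position set of $G$ if no vertex of $S$ lies on a shortest path between two other vertices of $S$; equivalently, $d_G(u,v)\ne d_G(u,w)+d_G(w,v)$ for all pairwise distinct $u,v,w\in S$. The general position number $\operatorname{gp}(G)$ is the maximum cardinality of a general position set of $G$. The strong product $G\boxtimes H$ has vertex set $V(G)\times V(H)$; distinct vertices $(u_x,u_y)$ and $(v_x,v_y)$ are adjacent if and only if ($u_x=v_x$ and $u_yv_y\in E(H)$), or ($u_y=v_y$ and $u_xv_x\in E(G)$), or ($u_xv_x\in E(G)$ and $u_yv_y\in E(H)$). $C_n$ is the cycle on $n$ vertices. *)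

theory Defs
  imports "Graph_Theory.Graph_Theory"
begin

text \<open>
  Finite simple graphs are rendered by \<^locale>\<open>pair_graph\<close>: an undirected edge
  \<open>uv\<close> is the pair of arcs \<open>(u, v)\<close> and \<open>(v, u)\<close>.
\<close>

text \<open>For \<open>n \<ge> 3\<close> this is the simple cycle on \<open>n\<close> vertices; for smaller \<open>n\<close> it degenerates.\<close>

definition cycle_graph :: "nat \<Rightarrow> nat pair_pre_digraph" where
  "cycle_graph n =
    \<lparr> pverts = {..<n},
      parcs = {(i, j). i < n \<and> j < n \<and> (j = Suc i mod n \<or> i = Suc j mod n)} \<rparr>"

definition strong_product ::
  "'a pair_pre_digraph \<Rightarrow> 'b pair_pre_digraph \<Rightarrow> ('a \<times> 'b) pair_pre_digraph" where
  "strong_product G H =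
    \<lparr> pverts = pverts G \<times> pverts H,
      parcs = {((ux, uy), (vx, vy)).
        (ux \<in> pverts G \<and> ux = vx \<and> (uy, vy) \<in> parcs H) \<or>
        (uy \<in> pverts H \<and> uy = vy \<and> (ux, vx) \<in> parcs G) \<or>
        ((ux, vx) \<in> parcs G \<and> (uy, vy) \<in> parcs H)} \<rparr>"

text \<open>Every edge has cost 1, so the cost of a walk is its length.\<close>

definition graph_dist :: "'a pair_pre_digraph \<Rightarrow> 'a \<Rightarrow> 'a \<Rightarrow> ereal" where
  "graph_dist G u v = wf_digraph.\<mu> (with_proj G) (\<lambda>_. 1) u v"

definition shortest_path :: "'a pair_pre_digraph \<Rightarrow> 'a \<Rightarrow> ('a \<times> 'a) list \<Rightarrow> 'a \<Rightarrow> bool" where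
  "shortest_path G u p v \<longleftrightarrow>
    pre_digraph.apath (with_proj G) u p v \<and> ereal (real (length p)) = graph_dist G u v"

definition general_position_set :: "'a pair_pre_digraph \<Rightarrow> 'a set \<Rightarrow> bool" where
  "general_position_set G S \<longleftrightarrow> S \<subseteq> pverts G \<and>
    \<not> (\<exists>u\<in>S. \<exists>v\<in>S. \<exists>w\<in>S. u \<noteq> v \<and> u \<noteq> w \<and> v \<noteq> w \<and>
        (\<exists>p. shortest_path G u p v \<and> w \<in> set (pre_digraph.awalk_verts (with_proj G) u p)))"

definition gp_number :: "'a pair_pre_digraph \<Rightarrow> nat" where
  "gp_number G = Max {card S | S. general_position_set G S}"

lemma (in wf_digraph) awalk_cost_one [simp]: "awalk_cost (\<lambda>_. 1) p = real (length p)"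
  by (induction p) auto

lemma pair_graph_cycle_graph:
  assumes "n \<ge> 3"
  shows "pair_graph (cycle_graph n)"
proof
  have mod_eq: "Suc i mod n = (if Suc i = n then 0 else Suc i)" if "i < n" for i
    using that by (auto simp: mod_Suc)
  show "finite (pverts (cycle_graph n))" by (simp add: cycle_graph_def)
  show "finite (parcs (cycle_graph n))"
    by (rule finite_subset[of _ "{..<n} \<times> {..<n}"]) (auto simp: cycle_graph_def)
  show "symmetric (with_proj (cycle_graph n))"
    by (auto simp: symmetric_def cycle_graph_def arcs_ends_conv intro!: symI)
  fix e assume e: "e \<in> parcs (cycle_graph n)"
  then show "fst e \<in> pverts (cycle_graph n)" "snd e \<in> pverts (cycle_graph n)"
    by (auto simp: cycle_graph_def)
  show "fst e \<noteq> snd e"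
    using e assms mod_eq by (auto simp: cycle_graph_def split: if_splits)
qed

lemma strongly_connected_cycle_graph:
  assumes "n \<ge> 3"
  shows "strongly_connected (with_proj (cycle_graph n))"
proof -
  interpret pair_graph "cycle_graph n" by (rule pair_graph_cycle_graph[OF assms])
  have from0: "0 \<rightarrow>\<^sup>*\<^bsub>with_proj (cycle_graph n)\<^esub> i" if "i < n" for i
    using that
  proof (induction i)
    case 0
    then have "0 \<in> pverts (cycle_graph n)" by (simp add: cycle_graph_def)
    then show ?case by (rule reachable_refl)
  next
    case (Suc i)
    have "(i, Suc i) \<in> parcs (cycle_graph n)"
      using Suc.prems by (auto simp: cycle_graph_def)
    with Suc show ?case by (intro reachable_adj_trans[of 0 i "Suc i"]) simp_all
  qed
  show ?thesis
  proof (rule strongly_connectedI)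
    show "verts (with_proj (cycle_graph n)) \<noteq> {}"
      using assms by (simp add: cycle_graph_def lessThan_empty_iff)
    fix u v assume "u \<in> verts (with_proj (cycle_graph n))" "v \<in> verts (with_proj (cycle_graph n))"
    then have "u < n" "v < n" by (auto simp: cycle_graph_def)
    then show "u \<rightarrow>\<^sup>*\<^bsub>with_proj (cycle_graph n)\<^esub> v"
      using from0 reachable_trans symmetric_reachable' by blast
  qed
qed

lemma pair_graph_strong_product:
  assumes "pair_graph G" "pair_graph H"
  shows "pair_graph (strong_product G H)"
proof -
  interpret G: pair_graph G by fact
  interpret H: pair_graph H by fact
  let ?P = "strong_product G H"
  have symG: "(a, b) \<in> parcs G \<Longrightarrow> (b, a) \<in> parcs G" for a b
    using G.arcs_symmetric by blast
  have symH: "(a, b) \<in> parcs H \<Longrightarrow> (b, a) \<in> parcs H" for a b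
    using H.arcs_symmetric by blast
  have wfG: "(a, b) \<in> parcs G \<Longrightarrow> a \<in> pverts G \<and> b \<in> pverts G \<and> a \<noteq> b" for a b
    using G.no_loops' G.in_arcsD1 G.in_arcsD2 by blast
  have wfH: "(a, b) \<in> parcs H \<Longrightarrow> a \<in> pverts H \<and> b \<in> pverts H \<and> a \<noteq> b" for a b
    using H.no_loops' H.in_arcsD1 H.in_arcsD2 by blast
  have sub: "parcs ?P \<subseteq> pverts ?P \<times> pverts ?P"
    using wfG wfH by (auto simp: strong_product_def)
  show ?thesis
  proof
    show fin: "finite (pverts ?P)"
      using G.pair_finite_verts H.pair_finite_verts by (simp add: strong_product_def)
    show "finite (parcs ?P)"
      using finite_subset[OF sub] fin by simp
    show "symmetric (with_proj ?P)"
      using symG symH by (auto simp: symmetric_def strong_product_def arcs_ends_conv intro!: symI)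
    fix e assume e: "e \<in> parcs ?P"
    then show "fst e \<in> pverts ?P" "snd e \<in> pverts ?P" using sub by auto
    show "fst e \<noteq> snd e" using e wfG wfH by (auto simp: strong_product_def)
  qed
qed

lemma strongly_connected_strong_product:
  assumes "pair_graph G" "pair_graph H"
    and "strongly_connected (with_proj G)" "strongly_connected (with_proj H)"
  shows "strongly_connected (with_proj (strong_product G H))"
proof -
  interpret G: pair_graph G by fact
  interpret H: pair_graph H by fact
  interpret P: pair_graph "strong_product G H"
    using assms(1,2) by (rule pair_graph_strong_product)
  let ?P = "with_proj (strong_product G H)"
  have refl: "(x, y) \<rightarrow>\<^sup>*\<^bsub>?P\<^esub> (x, y)" if "x \<in> pverts G" "y \<in> pverts H" for x y
    using that by (intro P.reachable_refl) (simp add: strong_product_def)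
  have left: "(a, y) \<rightarrow>\<^sup>*\<^bsub>?P\<^esub> (b, y)"
    if "a \<rightarrow>\<^sup>*\<^bsub>with_proj G\<^esub> b" "y \<in> pverts H" for a b y
    using that(1)
  proof (induction rule: G.reachable_induct)
    case base
    then show ?case using that(2) refl by simp
  next
    case (step c d)
    then have "((c, y), (d, y)) \<in> parcs (strong_product G H)"
      using that(2) by (auto simp: strong_product_def)
    with step.IH show ?case by (rule P.reachable_adj_trans)
  qed
  have right: "(x, a) \<rightarrow>\<^sup>*\<^bsub>?P\<^esub> (x, b)"
    if "a \<rightarrow>\<^sup>*\<^bsub>with_proj H\<^esub> b" "x \<in> pverts G" for a b x
    using that(1)
  proof (induction rule: H.reachable_induct)
    case base
    then show ?case using that(2) refl by simp
  next
    case (step c d)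
    then have "((x, c), (x, d)) \<in> parcs (strong_product G H)"
      using that(2) by (auto simp: strong_product_def)
    with step.IH show ?case by (rule P.reachable_adj_trans)
  qed
  show ?thesis
  proof (rule strongly_connectedI)
    show "verts ?P \<noteq> {}"
      using assms(3,4) by (auto simp: strong_product_def strongly_connected_def)
    fix u v assume uv: "u \<in> verts ?P" "v \<in> verts ?P"
    obtain a b c d where [simp]: "u = (a, b)" "v = (c, d)" by (cases u, cases v) auto
    have mem: "a \<in> pverts G" "c \<in> pverts G" "b \<in> pverts H" "d \<in> pverts H"
      using uv by (auto simp: strong_product_def)
    have "(a, b) \<rightarrow>\<^sup>*\<^bsub>?P\<^esub> (c, b)"
      using mem assms(3) by (intro left) (auto elim!: strongly_connectedE)
    moreover have "(c, b) \<rightarrow>\<^sup>*\<^bsub>?P\<^esub> (c, d)"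
      using mem assms(4) by (intro right) (auto elim!: strongly_connectedE)
    ultimately show "u \<rightarrow>\<^sup>*\<^bsub>?P\<^esub> v" using P.reachable_trans by simp
  qed
qed

lemma shortest_path_exists:
  assumes "pair_graph G" "strongly_connected (with_proj G)" "u \<in> pverts G" "v \<in> pverts G"
  shows "\<exists>p. shortest_path G u p v"
proof -
  interpret pair_graph G by fact
  have "u \<rightarrow>\<^sup>*\<^bsub>with_proj G\<^esub> v" using assms(2-4) by (auto elim!: strongly_connectedE)
  from min_cost_awalk[OF this, of "\<lambda>_. 1"]
  show ?thesis by (auto simp: shortest_path_def graph_dist_def)
qed

lemma general_position_set_iff_dist:
  assumes "pair_graph G" "strongly_connected (with_proj G)"
  shows "general_position_set G S \<longleftrightarrow> S \<subseteq> pverts G \<and>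
    (\<forall>u\<in>S. \<forall>v\<in>S. \<forall>w\<in>S. u \<noteq> v \<longrightarrow> u \<noteq> w \<longrightarrow> v \<noteq> w \<longrightarrow>
       graph_dist G u v \<noteq> graph_dist G u w + graph_dist G w v)"
proof -
  interpret pair_graph G by fact
  have le: "graph_dist G u v \<le> ereal (length p)" if "awalk u p v" for u v p
    using min_cost_le_walk_cost[OF that, of "\<lambda>_. 1"] by (simp add: graph_dist_def)
  have key: "(\<exists>p. shortest_path G u p v \<and> w \<in> set (awalk_verts u p)) \<longleftrightarrow>
      graph_dist G u v = graph_dist G u w + graph_dist G w v"
    if mem: "u \<in> pverts G" "v \<in> pverts G" "w \<in> pverts G" for u v w
  proof -
    obtain q where q: "apath u q w" "graph_dist G u w = ereal (length q)"
      using shortest_path_exists[OF assms mem(1,3)] by (auto simp: shortest_path_def)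
    obtain r where r: "apath w r v" "graph_dist G w v = ereal (length r)"
      using shortest_path_exists[OF assms mem(3,2)] by (auto simp: shortest_path_def)
    have walk: "awalk u (q @ r) v"
      using q r by (auto simp: apath_def)
    show ?thesis
    proof
      assume "\<exists>p. shortest_path G u p v \<and> w \<in> set (awalk_verts u p)"
      then obtain p where p: "awalk u p v" "ereal (length p) = graph_dist G u v"
          "w \<in> set (awalk_verts u p)"
        by (auto simp: shortest_path_def apath_def)
      obtain p1 p2 where dec: "p = p1 @ p2" "awalk u p1 w" "awalk w p2 v"
        using awalk_decomp[OF p(1,3)] by blast
      have "graph_dist G u v \<le> graph_dist G u w + graph_dist G w v"
        using le[OF walk] q r by simp
      moreover have "graph_dist G u w + graph_dist G w v \<le> graph_dist G u v"
        using le[OF dec(2)] le[OF dec(3)] p(2)[symmetric] q(2) r(2) dec(1) by simp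
      ultimately show "graph_dist G u v = graph_dist G u w + graph_dist G w v" by simp
    next
      assume eq: "graph_dist G u v = graph_dist G u w + graph_dist G w v"
      then have len: "graph_dist G u v = ereal (length (q @ r))" using q r by simp
      have "apath u (q @ r) v"
      proof (rule ccontr)
        assume "\<not> apath u (q @ r) v"
        then have "\<not> distinct (awalk_verts u (q @ r))" using walk by (simp add: apath_def)
        then obtain a b c where "awalk_cyc_decomp (q @ r) = (a, b, c)"
          by (metis prod_cases3)
        from awalk_cyc_decomp_has_prop[OF walk \<open>\<not> distinct _\<close>] this
        obtain x where abc: "q @ r = a @ b @ c" "awalk x b x" "b \<noteq> []"
          by auto
        then have "awalk u (a @ c) v"
          using walk by (auto dest!: awalk_ends_eqD)
        from le[OF this] have "length (a @ b @ c) \<le> length (a @ c)"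
          unfolding len abc(1) ereal_less_eq of_nat_le_iff .
        with abc(3) show False by simp
      qed
      moreover have "w \<in> set (awalk_verts u (q @ r))"
      proof -
        have "awlast u q = w" using q(1) by (auto simp: apath_def)
        moreover have "w \<in> set (awalk_verts w r)" using r(1) by (rule hd_in_awalk_verts)
        ultimately show ?thesis by (simp only: awalk_verts_append2[OF walk] set_append) simp
      qed
      ultimately show "\<exists>p. shortest_path G u p v \<and> w \<in> set (awalk_verts u p)"
        unfolding shortest_path_def len by blast
    qed
  qed
  show ?thesis
  proof (cases "S \<subseteq> pverts G")
    case True
    then have "u \<in> pverts G" if "u \<in> S" for u using that by blast
    with key show ?thesis
      unfolding general_position_set_def by (simp add: True cong: bex_cong ball_cong) blast
  qed (simp add: general_position_set_def)
qed

lemma gp_number_attained: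
  assumes "pair_graph G"
  shows "\<exists>S. general_position_set G S \<and> card S = gp_number G"
    and "general_position_set G S \<Longrightarrow> card S \<le> gp_number G"
proof -
  interpret pair_graph G by fact
  let ?A = "{card S | S. general_position_set G S}"
  have "?A \<subseteq> card ` Pow (pverts G)"
    by (auto simp: general_position_set_def)
  then have fin: "finite ?A"
    by (rule finite_subset) (simp add: pair_finite_verts)
  have "general_position_set G {}" by (simp add: general_position_set_def)
  then have "?A \<noteq> {}" by blast
  from Max_in[OF fin this] show "\<exists>S. general_position_set G S \<and> card S = gp_number G"
    by (auto simp: gp_number_def)
  show "general_position_set G S \<Longrightarrow> card S \<le> gp_number G"
    unfolding gp_number_def using fin by (intro Max_ge) auto
qed

end

theory Submission
  imports Defs
begin

text \<open>
  Distances in a strong product are maxima of the distances in the factors, and a distance in a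
  cycle is the shorter of two arcs. Cut a strip of \<open>s div 2 + 1\<close> consecutive columns out of
  \<open>C\<^sub>s \<boxtimes> C\<^sub>t\<close>. This is just short enough for the distance of two columns of the strip to be the
  difference of their positions, so the strip looks like a piece of space-time, with the columns as
  time and \<open>C\<^sub>t\<close> as space. Call \<open>p\<close> earlier than \<open>q\<close> if \<open>q\<close> comes after \<open>p\<close> in time by at
  least the distance of the two in space.

  By the triangle inequality, three successive points of this order satisfy
  \<open>d(p, r) = d(p, q) + d(q, r)\<close>. A general position set therefore has no chain of three points in
  a strip, so it is there the union of two antichains: its minimal points and the others. In an
  antichain all distances are distances in \<open>C\<^sub>t\<close>, and of any four vertices of a cycle one lies on a
  geodesic between two others, so an antichain has at most three points and a strip at most six
  (\<open>strip_card_le_6\<close>).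

  Each point lies in \<open>s div 2 + 1\<close> of the \<open>s\<close> strips, so double counting gives
  \<open>card S * (s div 2 + 1) \<le> 6 * s\<close> (\<open>strip_counting_bound\<close>). The same holds for \<open>t\<close> by symmetry,
  and the three cases of the theorem are what this inequality says for integers.
\<close>

section \<open>Distances in cycles and strong products\<close>

text \<open>
  The conditions characterise the distance from \<open>u\<close> locally: the second makes \<open>f\<close> a lower bound
  along any walk, and the third lets one descend from any vertex to \<open>u\<close> in \<open>f v\<close> steps.
\<close>

definition distance_layering :: "'a pair_pre_digraph \<Rightarrow> 'a \<Rightarrow> ('a \<Rightarrow> nat) \<Rightarrow> bool" where
  "distance_layering G u f \<longleftrightarrow> f u = 0 \<and>
    (\<forall>a b. (a, b) \<in> parcs G \<longrightarrow> f b \<le> Suc (f a)) \<and>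
    (\<forall>v\<in>pverts G. v \<noteq> u \<longrightarrow> (\<exists>a. (a, v) \<in> parcs G \<and> f v = Suc (f a)))"

lemma graph_dist_eq_layer:
  assumes "pair_graph G" and lay: "distance_layering G u f"
    and u: "u \<in> pverts G" and v: "v \<in> pverts G"
  shows "graph_dist G u v = ereal (real (f v))"
proof -
  interpret pair_graph G by fact
  have lower: "f b \<le> f a + length p" if "awalk a p b" for a b p
    using that
  proof (induction p arbitrary: a)
    case Nil
    then show ?case by (simp add: awalk_Nil_iff)
  next
    case (Cons e p)
    obtain c d where e: "e = (c, d)" by (cases e)
    from Cons.prems have "(a, d) \<in> parcs G" "awalk d p b"
      by (auto simp: awalk_Cons_iff e)
    then have "f d \<le> Suc (f a)" "f b \<le> f d + length p"
      using lay Cons.IH by (auto simp: distance_layering_def)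
    then show ?case by simp
  qed
  have "\<exists>p. awalk u p w \<and> length p = f w" if "w \<in> pverts G" for w
    using that
  proof (induction "f w" arbitrary: w rule: less_induct)
    case less
    show ?case
    proof (cases "w = u")
      case True
      then show ?thesis using u lay by (intro exI[of _ "[]"]) (simp add: awalk_Nil_iff distance_layering_def)
    next
      case False
      then obtain a where a: "(a, w) \<in> parcs G" "f w = Suc (f a)"
        using lay less.prems by (auto simp: distance_layering_def)
      then have "a \<in> pverts G" using in_arcsD1 by blast
      with less.hyps a obtain p where "awalk u p a" "length p = f a" by auto
      moreover have "awalk a [(a, w)] w"
        using a(1) arc_implies_awalk[of "(a, w)"] by simp
      ultimately have "awalk u (p @ [(a, w)]) w" "length (p @ [(a, w)]) = f w"
        using a(2) by auto
      then show ?thesis by blast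
    qed
  qed
  then obtain p where p: "awalk u p v" "length p = f v" using v by blast
  show ?thesis
  proof (rule antisym)
    show "graph_dist G u v \<le> ereal (real (f v))"
      using min_cost_le_walk_cost[OF p(1), of "\<lambda>_. 1"] p(2) by (simp add: graph_dist_def)
    show "ereal (real (f v)) \<le> graph_dist G u v"
      unfolding graph_dist_def \<mu>_def
    proof (rule INF_greatest)
      fix q assume "q \<in> {q. awalk u q v}"
      then have "f v \<le> length q" using lower[of u q v] lay by (simp add: distance_layering_def)
      then show "ereal (real (f v)) \<le> ereal (awalk_cost (\<lambda>_. 1) q)" by simp
    qed
  qed
qed

lemma distance_layering_pos:
  assumes "distance_layering G u f" "x \<in> pverts G" "x \<noteq> u"
  shows "f x > 0"
  using assms unfolding distance_layering_def by (metis zero_less_Suc)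

lemma distance_layering_step:
  assumes f: "distance_layering G u f" and x: "x \<in> pverts G" and le: "f x \<le> Suc m"
  obtains a where "a = x \<or> (a, x) \<in> parcs G" "f a \<le> m"
    "f x = Suc m \<Longrightarrow> (a, x) \<in> parcs G \<and> f a = m"
proof (cases "f x = Suc m")
  case True
  then have "x \<noteq> u" using f by (auto simp: distance_layering_def)
  then have "\<exists>a. (a, x) \<in> parcs G \<and> f x = Suc (f a)"
    using f x unfolding distance_layering_def by blast
  then show ?thesis using True that by auto
next
  case False
  then show ?thesis using le that[of x] by auto
qed

text \<open>
  To descend in a strong product, one descends in each factor that attains the maximum and may
  stay put in the other one.
\<close>

lemma distance_layering_strong_product:
  assumes f: "distance_layering G u f" and g: "distance_layering H w g"
    and G: "pair_graph G" and H: "pair_graph H"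
  shows "distance_layering (strong_product G H) (u, w) (\<lambda>(x, y). max (f x) (g y))"
proof -
  have descend: "\<exists>a b. ((a, b), (x, y)) \<in> parcs (strong_product G H) \<and>
      max (f x) (g y) = Suc (max (f a) (g b))"
    if mem: "x \<in> pverts G" "y \<in> pverts H" and ne: "(x, y) \<noteq> (u, w)" for x y
  proof -
    have "max (f x) (g y) > 0"
      using ne distance_layering_pos[OF f mem(1)] distance_layering_pos[OF g mem(2)]
      by (auto simp: less_max_iff_disj)
    then obtain m where m: "max (f x) (g y) = Suc m" using gr0_implies_Suc by blast
    then have le: "f x \<le> Suc m" "g y \<le> Suc m" by (auto simp flip: m)
    obtain a where a: "a = x \<or> (a, x) \<in> parcs G" "f a \<le> m"
        "f x = Suc m \<Longrightarrow> (a, x) \<in> parcs G \<and> f a = m"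
      using distance_layering_step[OF f mem(1) le(1)] by metis
    obtain b where b: "b = y \<or> (b, y) \<in> parcs H" "g b \<le> m"
        "g y = Suc m \<Longrightarrow> (b, y) \<in> parcs H \<and> g b = m"
      using distance_layering_step[OF g mem(2) le(2)] by metis
    have "f x = Suc m \<or> g y = Suc m" using m by (auto simp: max_def split: if_splits)
    then have "((a, b), (x, y)) \<in> parcs (strong_product G H)" "max (f a) (g b) = m"
      using a b mem by (auto simp: strong_product_def)
    then show ?thesis using m by auto
  qed
  have "f b \<le> Suc (f a)" if "(a, b) \<in> parcs G" for a b
    using that f by (auto simp: distance_layering_def)
  moreover have "g b \<le> Suc (g a)" if "(a, b) \<in> parcs H" for a b
    using that g by (auto simp: distance_layering_def)
  ultimately have lip: "max (f x') (g y') \<le> Suc (max (f x) (g y))"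
    if "((x, y), (x', y')) \<in> parcs (strong_product G H)" for x y x' y'
    using that by (fastforce simp: strong_product_def max_def)
  show ?thesis
    unfolding distance_layering_def
  proof (intro conjI allI ballI impI)
    show "(case (u, w) of (x, y) \<Rightarrow> max (f x) (g y)) = 0"
      using f g by (simp add: distance_layering_def)
  next
    fix p q assume "(p, q) \<in> parcs (strong_product G H)"
    then show "(case q of (x, y) \<Rightarrow> max (f x) (g y)) \<le> Suc (case p of (x, y) \<Rightarrow> max (f x) (g y))"
      using lip by (cases p, cases q) auto
  next
    fix v assume "v \<in> pverts (strong_product G H)" "v \<noteq> (u, w)"
    then show "\<exists>a. (a, v) \<in> parcs (strong_product G H) \<and>
        (case v of (x, y) \<Rightarrow> max (f x) (g y)) = Suc (case a of (x, y) \<Rightarrow> max (f x) (g y))"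
      using descend[of "fst v" "snd v"] by (cases v) (auto simp: strong_product_def)
  qed
qed

definition cycle_dist :: "nat \<Rightarrow> nat \<Rightarrow> nat \<Rightarrow> nat" where
  "cycle_dist n i j = min (nat \<bar>int i - int j\<bar>) (n - nat \<bar>int i - int j\<bar>)"

lemma cycle_dist_commute: "cycle_dist n i j = cycle_dist n j i"
  by (simp add: cycle_dist_def abs_minus_commute)

lemma cycle_dist_ordered: "i \<le> j \<Longrightarrow> cycle_dist n i j = min (j - i) (n - (j - i))"
proof -
  assume "i \<le> j"
  then have "nat \<bar>int i - int j\<bar> = j - i" by simp
  then show ?thesis by (simp only: cycle_dist_def)
qed

lemma cycle_dist_short: "\<lbrakk>i \<le> j; 2 * (j - i) \<le> n\<rbrakk> \<Longrightarrow> cycle_dist n i j = j - i"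
  by (simp add: cycle_dist_ordered)

lemma cycle_dist_long: "\<lbrakk>i \<le> j; n \<le> 2 * (j - i)\<rbrakk> \<Longrightarrow> cycle_dist n i j = n - (j - i)"
  by (simp add: cycle_dist_ordered)

lemma cycle_dist_triangle:
  assumes "i < n" "j < n" "k < n"
  shows "cycle_dist n i k \<le> cycle_dist n i j + cycle_dist n j k"
proof -
  define a b c where abc: "a = \<bar>int i - int k\<bar>" "b = \<bar>int i - int j\<bar>" "c = \<bar>int j - int k\<bar>"
  have val: "int (cycle_dist n x y) = min \<bar>int x - int y\<bar> (int n - \<bar>int x - int y\<bar>)"
    if "x < n" "y < n" for x y
    using that by (simp add: cycle_dist_def of_nat_min of_nat_diff nat_le_iff abs_le_iff)
  \<comment> \<open>Each inequality covers one choice of inner or outer arc for the two distances on the right;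
    the bound by \<open>2 * n\<close> is for two outer arcs.\<close>
  have "a \<le> b + c" "b \<le> a + c" "c \<le> a + b" "a + b + c \<le> 2 * int n"
    using assms unfolding abc by linarith+
  then have "min a (int n - a) \<le> min b (int n - b) + min c (int n - c)"
    by (simp add: min_def)
  then have "int (cycle_dist n i k) \<le> int (cycle_dist n i j) + int (cycle_dist n j k)"
    by (simp only: val assms abc)
  then show ?thesis by (simp flip: of_nat_add)
qed

lemma cycle_dist_eq_0_iff:
  assumes "i < n" "j < n"
  shows "cycle_dist n i j = 0 \<longleftrightarrow> i = j"
  using assms by (auto simp: cycle_dist_def min_def)

lemma distance_layering_cycle:
  assumes "n \<ge> 3" "u < n"
  shows "distance_layering (cycle_graph n) u (cycle_dist n u)"
proof -
  have nxt: "Suc i mod n = (if Suc i = n then 0 else Suc i)" if "i < n" for i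
    using that by (auto simp: mod_Suc)
  have adjacent: "cycle_dist n i j \<le> 1" if "(i, j) \<in> parcs (cycle_graph n)" for i j
  proof -
    have forward: "cycle_dist n i (Suc i mod n) \<le> 1" if "i < n" for i
      using that assms
      by (auto simp: nxt cycle_dist_long cycle_dist_ordered cycle_dist_commute[of n i 0])
    have "i < n" "j < n" "j = Suc i mod n \<or> i = Suc j mod n"
      using that by (auto simp: cycle_graph_def)
    then show ?thesis using forward cycle_dist_commute[of n i j] by metis
  qed
  have lip: "cycle_dist n u j \<le> Suc (cycle_dist n u i)" if "(i, j) \<in> parcs (cycle_graph n)" for i j
  proof -
    have "i < n" "j < n" using that by (auto simp: cycle_graph_def)
    then show ?thesis
      using cycle_dist_triangle[of u n i j] adjacent[OF that] assms by linarith
  qed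
  have "\<exists>a. (a, v) \<in> parcs (cycle_graph n) \<and> cycle_dist n u v = Suc (cycle_dist n u a)"
    if v: "v < n" "v \<noteq> u" for v
  proof -
    define up where "up = Suc v mod n"
    define down where "down = (if v = 0 then n - 1 else v - 1)"
    have "(up, v) \<in> parcs (cycle_graph n)"
      using v by (auto simp: cycle_graph_def up_def)
    moreover have "(down, v) \<in> parcs (cycle_graph n)"
      using v assms by (auto simp: cycle_graph_def down_def)
    moreover have "cycle_dist n u v = Suc (cycle_dist n u up) \<or>
        cycle_dist n u v = Suc (cycle_dist n u down)"
      \<comment> \<open>The neighbour on the shorter of the two arcs from \<open>v\<close> to \<open>u\<close> is closer to \<open>u\<close>.\<close>
    proof -
      consider "u < v" "2 * (v - u) \<le> n" | "u < v" "n < 2 * (v - u)"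
        | "v < u" "2 * (u - v) \<le> n" | "v < u" "n < 2 * (u - v)"
        using v by linarith
      then show ?thesis
      proof cases
        case 1
        then show ?thesis by (simp add: down_def cycle_dist_short Suc_diff_Suc)
      next
        case 2
        have "Suc (cycle_dist n u up) = n - (v - u)"
        proof (cases "Suc v = n")
          case True
          then have "up = 0" "2 * u \<le> n" using 2 v nxt by (simp_all add: up_def)
          then have "cycle_dist n u up = u"
            using cycle_dist_short[of 0 u n] cycle_dist_commute[of n u 0] by simp
          then show ?thesis using True 2 by simp
        next
          case False
          then have "up = Suc v" using v nxt by (simp add: up_def)
          then have "cycle_dist n u up = n - (Suc v - u)"
            using 2 by (simp add: cycle_dist_long)
          then show ?thesis using v 2 by linarith
        qed
        then show ?thesis using 2 by (simp add: cycle_dist_long)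
      next
        case 3
        then have "up = Suc v" using v assms nxt by (simp add: up_def)
        then have "cycle_dist n u up = u - Suc v"
          using 3 cycle_dist_short[of "Suc v" u n] cycle_dist_commute[of n u "Suc v"] by simp
        moreover have "cycle_dist n u v = u - v"
          using 3 cycle_dist_short[of v u n] cycle_dist_commute[of n u v] by simp
        ultimately show ?thesis using 3 by (simp add: Suc_diff_Suc)
      next
        case 4
        have "Suc (cycle_dist n u down) = n - (u - v)"
        proof (cases "v = 0")
          case True
          then have "cycle_dist n u down = n - 1 - u"
            using 4 assms by (simp add: down_def cycle_dist_short)
          then show ?thesis using True assms by simp
        next
          case False
          then have "cycle_dist n u down = n - (u - (v - 1))"
            using 4 cycle_dist_long[of "v - 1" u n] cycle_dist_commute[of n u "v - 1"]
            by (simp add: down_def)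
          then show ?thesis using False 4 assms by linarith
        qed
        moreover have "cycle_dist n u v = n - (u - v)"
          using 4 cycle_dist_long[of v u n] cycle_dist_commute[of n u v] by simp
        ultimately show ?thesis by simp
      qed
    qed
    ultimately show ?thesis by blast
  qed
  moreover have "cycle_dist n u u = 0" by (simp add: cycle_dist_def)
  ultimately show ?thesis
    using lip unfolding distance_layering_def by (auto simp: cycle_graph_def)
qed

definition torus_dist :: "nat \<Rightarrow> nat \<Rightarrow> nat \<times> nat \<Rightarrow> nat \<times> nat \<Rightarrow> nat" where
  "torus_dist s t p q = max (cycle_dist s (fst p) (fst q)) (cycle_dist t (snd p) (snd q))"

lemma graph_dist_torus:
  assumes "s \<ge> 3" "t \<ge> 3" "p \<in> {..<s} \<times> {..<t}" "q \<in> {..<s} \<times> {..<t}"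
  shows "graph_dist (strong_product (cycle_graph s) (cycle_graph t)) p q
    = ereal (real (torus_dist s t p q))"
proof -
  obtain a b where p: "p = (a, b)" "a < s" "b < t" using assms(3) by auto
  note G = pair_graph_cycle_graph[OF assms(1)] and H = pair_graph_cycle_graph[OF assms(2)]
  have "distance_layering (strong_product (cycle_graph s) (cycle_graph t)) (a, b)
      (\<lambda>(x, y). max (cycle_dist s a x) (cycle_dist t b y))"
    using assms p G H by (intro distance_layering_strong_product distance_layering_cycle)
  from graph_dist_eq_layer[OF pair_graph_strong_product[OF G H] this, of q] p assms(4)
  show ?thesis
    by (auto simp: strong_product_def cycle_graph_def torus_dist_def)
qed

definition torus_general_position :: "nat \<Rightarrow> nat \<Rightarrow> (nat \<times> nat) set \<Rightarrow> bool" where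
  "torus_general_position s t S \<longleftrightarrow> S \<subseteq> {..<s} \<times> {..<t} \<and>
    (\<forall>u\<in>S. \<forall>v\<in>S. \<forall>w\<in>S. u \<noteq> v \<longrightarrow> u \<noteq> w \<longrightarrow> v \<noteq> w \<longrightarrow>
      torus_dist s t u v \<noteq> torus_dist s t u w + torus_dist s t w v)"

lemma general_position_set_torus_iff:
  assumes "s \<ge> 3" "t \<ge> 3"
  shows "general_position_set (strong_product (cycle_graph s) (cycle_graph t)) S
    \<longleftrightarrow> torus_general_position s t S"
proof -
  note G = pair_graph_cycle_graph[OF assms(1)] and H = pair_graph_cycle_graph[OF assms(2)]
  note conn = strongly_connected_strong_product[OF G H
      strongly_connected_cycle_graph[OF assms(1)] strongly_connected_cycle_graph[OF assms(2)]]
  have V: "pverts (strong_product (cycle_graph s) (cycle_graph t)) = {..<s} \<times> {..<t}"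
    by (simp add: strong_product_def cycle_graph_def)
  show ?thesis
  proof (cases "S \<subseteq> {..<s} \<times> {..<t}")
    case True
    then have "graph_dist (strong_product (cycle_graph s) (cycle_graph t)) p q
        = ereal (real (torus_dist s t p q))" if "p \<in> S" "q \<in> S" for p q
      using that by (intro graph_dist_torus[OF assms]) auto
    then show ?thesis
      unfolding general_position_set_iff_dist[OF pair_graph_strong_product[OF G H] conn]
        torus_general_position_def V
      by (simp flip: of_nat_add)
  next
    case False
    then show ?thesis
      by (simp add: torus_general_position_def general_position_set_def V)
  qed
qed

lemma torus_general_position_swap:
  assumes "torus_general_position s t S"
  shows "torus_general_position t s (prod.swap ` S)"
proof -
  have "torus_dist t s (prod.swap p) (prod.swap q) = torus_dist s t p q" for p q
    by (simp add: torus_dist_def max.commute)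
  moreover have "prod.swap p = prod.swap q \<longleftrightarrow> p = q" for p q :: "nat \<times> nat"
    by (auto simp: prod.swap_def prod_eq_iff)
  ultimately show ?thesis
    using assms unfolding torus_general_position_def by (simp add: ball_simps) auto
qed

section \<open>At most six points in a strip\<close>

text \<open>
  The vertices \<open>a\<close> and \<open>c\<close> cut the cycle into two arcs. The arc that is not longer is a geodesic,
  and it contains \<open>b\<close> or \<open>d\<close>.
\<close>

lemma cycle_dist_between_of_four:
  assumes "a < b" "b < c" "c < d" "d < n"
  shows "cycle_dist n a c = cycle_dist n a b + cycle_dist n b c \<or>
    cycle_dist n c a = cycle_dist n c d + cycle_dist n d a"
proof (cases "2 * (c - a) \<le> n")
  case True
  then show ?thesis using assms by (simp add: cycle_dist_short)
next
  case False
  then have "cycle_dist n c a = n - (c - a)" "cycle_dist n c d = d - c"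
      "cycle_dist n d a = n - (d - a)"
    using assms by (simp_all add: cycle_dist_short cycle_dist_long cycle_dist_commute[of n _ a])
  then show ?thesis using assms by simp
qed

lemma cycle_no_between_card_le_3:
  assumes Y: "Y \<subseteq> {..<n}"
    and no: "\<And>a b c. \<lbrakk>a \<in> Y; b \<in> Y; c \<in> Y; a \<noteq> b; b \<noteq> c; a \<noteq> c\<rbrakk>
      \<Longrightarrow> cycle_dist n a c \<noteq> cycle_dist n a b + cycle_dist n b c"
  shows "card Y \<le> 3"
proof (rule ccontr)
  assume "\<not> card Y \<le> 3"
  define ys where "ys = sorted_list_of_set Y"
  have fin: "finite Y" using Y finite_subset by blast
  have len: "3 < length ys" using \<open>\<not> card Y \<le> 3\<close> by (simp add: ys_def)
  have less: "ys ! i < ys ! j" if "i < j" "j < 4" for i j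
    using that len sorted_wrt_nth_less[OF strict_sorted_list_of_set[of Y], of i j]
    by (simp add: ys_def)
  have mem: "ys ! i \<in> Y" if "i < 4" for i
    using that len fin nth_mem[of i ys] by (simp add: ys_def)
  note l = less[of 0 1] less[of 1 2] less[of 2 3]
  have "ys ! 3 < n" using mem[of 3] Y by auto
  with l have "cycle_dist n (ys ! 0) (ys ! 2) =
        cycle_dist n (ys ! 0) (ys ! 1) + cycle_dist n (ys ! 1) (ys ! 2) \<or>
      cycle_dist n (ys ! 2) (ys ! 0) =
        cycle_dist n (ys ! 2) (ys ! 3) + cycle_dist n (ys ! 3) (ys ! 0)"
    by (intro cycle_dist_between_of_four) auto
  moreover have "cycle_dist n (ys ! 0) (ys ! 2) \<noteq>
        cycle_dist n (ys ! 0) (ys ! 1) + cycle_dist n (ys ! 1) (ys ! 2)"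
    using l mem by (intro no) auto
  moreover have "cycle_dist n (ys ! 2) (ys ! 0) \<noteq>
        cycle_dist n (ys ! 2) (ys ! 3) + cycle_dist n (ys ! 3) (ys ! 0)"
    using l mem by (intro no) auto
  ultimately show False by blast
qed

text \<open>
  With \<open>h\<close> as time, a chain of three points is a timelike path: its time differences add up, and
  by the triangle inequality its ends are again at least as far apart in time as in space, so the
  middle point lies on a geodesic. Hence the points that have an earlier point form an antichain,
  and so do the remaining ones. The distances in an antichain come from \<open>C\<^sub>t\<close>, where four vertices
  are too many.
\<close>

lemma strip_card_le_6:
  fixes h :: "nat \<times> nat \<Rightarrow> int"
  assumes gp: "torus_general_position s t S" and T: "T \<subseteq> S"
    and h: "\<And>p q. \<lbrakk>p \<in> T; q \<in> T\<rbrakk> \<Longrightarrow> int (cycle_dist s (fst p) (fst q)) = \<bar>h p - h q\<bar>"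
  shows "card T \<le> 6"
proof -
  define \<rho> where "\<rho> p q = int (cycle_dist t (snd p) (snd q))" for p q :: "nat \<times> nat"
  define earlier where "earlier p q \<longleftrightarrow> p \<noteq> q \<and> h q - h p \<ge> \<rho> p q" for p q
  have box: "fst p < s" "snd p < t" if "p \<in> T" for p
    using that T gp by (auto simp: torus_general_position_def)
  have D: "int (torus_dist s t p q) = max \<bar>h p - h q\<bar> (\<rho> p q)" if "p \<in> T" "q \<in> T" for p q
    unfolding torus_dist_def \<rho>_def using h[OF that] by (simp add: of_nat_max)
  have apart: "\<not> torus_dist s t p r = torus_dist s t p q + torus_dist s t q r"
    if "p \<in> T" "q \<in> T" "r \<in> T" "p \<noteq> q" "q \<noteq> r" "p \<noteq> r" for p q r
    using that T gp unfolding torus_general_position_def by (metis subsetD)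
  have \<rho>_nonneg: "\<rho> p q \<ge> 0" and \<rho>_commute: "\<rho> p q = \<rho> q p" for p q
    by (simp_all add: \<rho>_def cycle_dist_commute)
  have no_chain: False
    if mem: "p \<in> T" "q \<in> T" "r \<in> T" and pq: "earlier p q" and qr: "earlier q r" for p q r
  proof -
    have tri: "\<rho> p r \<le> \<rho> p q + \<rho> q r"
      using cycle_dist_triangle[of "snd p" t "snd q" "snd r"] box mem by (simp add: \<rho>_def)
    have "p \<noteq> r"
    proof
      assume "p = r"
      then have "h p = h q" "\<rho> p q = 0"
        using pq qr \<rho>_nonneg[of p q] \<rho>_nonneg[of q p] \<rho>_commute[of p q] by (auto simp: earlier_def)
      then have "snd p = snd q" "fst p = fst q"
        using h[of p q] box mem cycle_dist_eq_0_iff by (simp_all add: \<rho>_def)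
      then show False using pq by (simp add: earlier_def prod_eq_iff)
    qed
    moreover have "int (torus_dist s t p r) = int (torus_dist s t p q) + int (torus_dist s t q r)"
      using pq qr tri \<rho>_nonneg[of p q] \<rho>_nonneg[of q r]
      by (simp add: D mem earlier_def)
    ultimately show False
      using apart[of p q r] mem pq qr by (auto simp: earlier_def simp flip: of_nat_add)
  qed
  have antichain: "card A \<le> 3"
    if A: "A \<subseteq> T" and anti: "\<And>p q. \<lbrakk>p \<in> A; q \<in> A\<rbrakk> \<Longrightarrow> \<not> earlier p q" for A
  proof -
    have space: "\<bar>h p - h q\<bar> < \<rho> p q" if "p \<in> A" "q \<in> A" "p \<noteq> q" for p q
      using anti[of p q] anti[of q p] that \<rho>_commute[of p q] by (auto simp: earlier_def)
    have dist: "torus_dist s t p q = cycle_dist t (snd p) (snd q)"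
      if "p \<in> A" "q \<in> A" "p \<noteq> q" for p q
    proof -
      have "int (torus_dist s t p q) = \<rho> p q"
        using space[OF that] D[of p q] subsetD[OF A that(1)] subsetD[OF A that(2)] by simp
      then show ?thesis by (simp add: \<rho>_def)
    qed
    have inj: "inj_on snd A"
    proof (rule inj_onI, rule ccontr)
      fix p q assume "p \<in> A" "q \<in> A" "snd p = snd q" "p \<noteq> q"
      then show False using space[of p q] by (simp add: \<rho>_def cycle_dist_def)
    qed
    have "card (snd ` A) \<le> 3"
    proof (rule cycle_no_between_card_le_3[where n = t])
      show "snd ` A \<subseteq> {..<t}" using box A by auto
      fix a b c assume "a \<in> snd ` A" "b \<in> snd ` A" "c \<in> snd ` A" and ne: "a \<noteq> b" "b \<noteq> c" "a \<noteq> c"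
      then obtain p q r where "p \<in> A" "q \<in> A" "r \<in> A" "a = snd p" "b = snd q" "c = snd r" by blast
      then show "cycle_dist t a c \<noteq> cycle_dist t a b + cycle_dist t b c"
        using apart[of p q r] dist[of p q] dist[of q r] dist[of p r] A ne by auto
    qed
    then show ?thesis by (simp add: card_image inj)
  qed
  define A where "A = {p \<in> T. \<forall>q\<in>T. \<not> earlier q p}"
  have "card A \<le> 3" by (rule antichain) (auto simp: A_def)
  moreover have "card (T - A) \<le> 3"
    using no_chain by (intro antichain) (auto simp: A_def)
  moreover have "card T \<le> card A + card (T - A)"
    using card_Un_le[of A "T - A"] by (simp add: A_def Un_absorb1 Collect_restrict)
  ultimately show ?thesis by simp
qed

section \<open>Counting points over all strips\<close>

text \<open>The position of the column \<open>x\<close> when the columns are counted cyclically from column \<open>a\<close>.\<close>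

definition column_offset :: "nat \<Rightarrow> nat \<Rightarrow> nat \<Rightarrow> nat" where
  "column_offset s a x = (if a \<le> x then x - a else x + s - a)"

text \<open>
  Two of \<open>s div 2 + 1\<close> consecutive columns differ by at most \<open>s div 2\<close>, so the arc between them
  inside the strip is the shorter one.
\<close>

lemma cycle_dist_in_strip:
  assumes "a < s" "x < s" "y < s"
    and "column_offset s a x \<le> s div 2" "column_offset s a y \<le> s div 2"
  shows "int (cycle_dist s x y) = \<bar>int (column_offset s a x) - int (column_offset s a y)\<bar>"

proof -
  have ordered: "int (cycle_dist s x y) = \<bar>int (column_offset s a x) - int (column_offset s a y)\<bar>"
    if le: "x \<le> y" and strip: "x < s" "y < s"
      "column_offset s a x \<le> s div 2" "column_offset s a y \<le> s div 2" for x y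
  proof (cases "x < a \<and> a \<le> y")
    case True
    then have off: "column_offset s a x = x + s - a" "column_offset s a y = y - a"
      by (simp_all add: column_offset_def)
    then have "s \<le> 2 * (y - x)" using True strip(3) assms(1) by linarith
    then have "cycle_dist s x y = s - (y - x)" using le by (simp add: cycle_dist_long)
    then show ?thesis using True strip le assms(1) unfolding off by (simp add: of_nat_diff)
  next
    case False
    then have diff: "int (column_offset s a y) - int (column_offset s a x) = int (y - x)"
      using le assms(1) by (auto simp: column_offset_def of_nat_diff)
    then have "2 * (y - x) \<le> s" using strip(4) by linarith
    then show ?thesis using diff le by (simp add: cycle_dist_short)
  qed
  show ?thesis
  proof (cases "x \<le> y")
    case True
    then show ?thesis using ordered assms by blast
  next
    case False
    then have "int (cycle_dist s y x) = \<bar>int (column_offset s a y) - int (column_offset s a x)\<bar>"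
      using assms by (intro ordered) auto
    then show ?thesis by (simp add: cycle_dist_commute[of s x] abs_minus_commute)
  qed
qed

lemma card_strips_containing:
  assumes "x < s"
  shows "card {a \<in> {..<s}. column_offset s a x \<le> s div 2} = s div 2 + 1"
proof -
  have "bij_betw (\<lambda>i. column_offset s i x) {a \<in> {..<s}. column_offset s a x \<le> s div 2} {..s div 2}"
    using assms
    \<comment> \<open>Offset \<open>i\<close> from \<open>a\<close> to \<open>x\<close> means that \<open>a\<close> is at offset \<open>s - i\<close> from \<open>x\<close>, or at \<open>x\<close> itself.\<close>
    by (intro bij_betw_byWitness[where f' = "\<lambda>i. if i \<le> x then x - i else x + s - i"])
      (auto simp: column_offset_def split: if_splits)
  from bij_betw_same_card[OF this] show ?thesis by simp
qed

lemma strip_counting_bound: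
  assumes gp: "torus_general_position s t S"
  shows "card S * (s div 2 + 1) \<le> 6 * s"
proof -
  have S: "S \<subseteq> {..<s} \<times> {..<t}" using gp by (simp add: torus_general_position_def)
  then have fin: "finite S" by (rule finite_subset) simp
  let ?R = "\<lambda>a p. column_offset s a (fst p) \<le> s div 2"
  have "card S * (s div 2 + 1) = (\<Sum>a<s. card {p \<in> S. ?R a p})"
    using S card_strips_containing
    by (subst sum_multicount[where T = S and k = "s div 2 + 1"]) (auto simp: fin)
  also have "\<dots> \<le> (\<Sum>a<s. 6)"
  proof (rule sum_mono)
    fix a assume "a \<in> {..<s}"
    then show "card {p \<in> S. ?R a p} \<le> 6"
      using S by (intro strip_card_le_6[OF gp, where h = "\<lambda>p. int (column_offset s a (fst p))"]
          cycle_dist_in_strip) auto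
  qed
  finally show ?thesis by simp
qed

section \<open>The bound\<close>

theorem proposition4p1:
  fixes s t :: nat
  assumes "s \<ge> 7" and "t \<ge> 7"
  shows "gp_number (strong_product (cycle_graph s) (cycle_graph t)) \<le>
    (if 8 \<in> {s, t} then 9
     else if {s, t} \<inter> {7, 9, 10, 12, 14, 16, 18, 20} \<noteq> {} then 10
     else 11)"
proof -
  have graph: "pair_graph (strong_product (cycle_graph s) (cycle_graph t))"
    using assms by (intro pair_graph_strong_product pair_graph_cycle_graph) auto
  obtain S where S: "torus_general_position s t S"
      "gp_number (strong_product (cycle_graph s) (cycle_graph t)) = card S"
    using gp_number_attained(1)[OF graph] general_position_set_torus_iff[of s t] assms by auto
  have "card S * (s div 2 + 1) \<le> 6 * s"
    by (rule strip_counting_bound[OF S(1)])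
  moreover have "card S * (t div 2 + 1) \<le> 6 * t"
    using strip_counting_bound[OF torus_general_position_swap[OF S(1)]] by (simp add: card_image)
  moreover have general: "N \<le> 11" if "N * (n div 2 + 1) \<le> 6 * n" for N n :: nat
  proof (rule ccontr)
    assume "\<not> N \<le> 11"
    then have "12 * (n div 2 + 1) \<le> N * (n div 2 + 1)" by (intro mult_right_mono) auto
    then have "12 * (n div 2 + 1) \<le> 6 * n" using that by (rule order_trans)
    then show False by presburger
  qed
  moreover have "N \<le> 9" if "N * (n div 2 + 1) \<le> 6 * n" "n = 8" for N n :: nat
    using that by simp
  moreover have "N \<le> 10"
    if "N * (n div 2 + 1) \<le> 6 * n" "n \<in> {7, 9, 10, 12, 14, 16, 18, 20}" for N n :: nat
    using that by auto
  ultimately show ?thesis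
    unfolding S(2) by (auto split: if_splits)
qed

end
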